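(* (Length Function Theorem for Ordinals.) Let $g:\mathbb{N}\to\mathbb{N}$ be monotone and expansive, let $\alpha<\varepsilon_0$, and let $x\in\mathbb{N}$ with $x\geq N\alpha$. Then $L_{g,\alpha}(x)=g_\alpha(x)$.
   Context: A function $g:\mathbb{N}\to\mathbb{N}$ is monotone if $x\leq x'$ implies $g(x)\leq g(x')$, and expansive if $x\leq g(x)$; $g^i$ is its $i$-th iterate. Ordinals below $\varepsilon_0$ are terms in Cantor normal form $\alpha=\omega^{\alpha_1}\cdot c_1+\cdots+\omega^{\alpha_p}\cdot c_p$ with $\alpha>\alpha_1>\cdots>\alpha_p$ and $0<c_1,\dots,c_p<\omega$; the norm is $N\alpha=\max\{c_1,\dots,c_p,N\alpha_1,\dots,N\alpha_p\}$ ($N0=0$). The ordinal $\alpha$ is identified with the set of ordinals below it, ordered by the usual ordinal order and normed by $N$. A sequence $\beta_0,\beta_1,\dots$ of ordinals in $\alpha$ is bad iff it is strictly decreasing ($\beta_0>\beta_1>\cdots$), and it is $(g,n)$-controlled if $N\beta_i\leq g^i(n)$ for all $i$. $L_{g,\alpha}(n)$ denotes the maximal length of a $(g,n)$-controlled bad sequence over $\alpha$. Fundamental sequences: for a limit written $\gamma+\omega^{\beta}$ ($\beta$ the last CNF exponent), $(\gamma+\omega^{\beta+1})(x)=\gamma+\omega^{\beta}\cdot(x+1)$ and $(\gamma+\omega^{\lambda})(x)=\gamma+\omega^{\lambda(x)}$ for limit $\lambda$. Predecessor of $\alpha>0$: $P_x(\alpha+1)=\alpha$, $P_x(\lambda)=P_x(\lambda(x))$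 for limit $\lambda$. Cichoń hierarchy: $g_0(x)=0$ and $g_\alpha(x)=1+g_{P_x(\alpha)}(g(x))$ for $0<\alpha<\varepsilon_0$. *)

theory Defs
  imports Main "HOL-Library.Extended_Nat"
begin

section \<open>Cantor normal forms below epsilon zero\<close>

text \<open>\<open>OTerm a c b\<close> stands for \<open>\<omega>\<^bsup>a\<^esup> \<cdot> c + b\<close>.\<close>

datatype oterm = OZero | OTerm oterm nat oterm

text \<open>On Cantor normal forms, the ordinal order is the lexicographic comparison of leading
  exponent, leading coefficient and remainder.\<close>

instantiation oterm :: linorder
begin

fun less_oterm :: "oterm \<Rightarrow> oterm \<Rightarrow> bool" where
  "s < OZero \<longleftrightarrow> False"
| "OZero < OTerm a c b \<longleftrightarrow> True"
| "OTerm a c b < OTerm a' c' b' \<longleftrightarrow>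
     a < a' \<or> a = a' \<and> (c < c' \<or> c = c' \<and> b < b')"

definition less_eq_oterm :: "oterm \<Rightarrow> oterm \<Rightarrow> bool" where
  "s \<le> t \<longleftrightarrow> s < t \<or> s = (t :: oterm)"

lemma less_oterm_irrefl: "\<not> s < (s :: oterm)"
  by (induction s) auto

lemma less_oterm_trans: "s < t \<Longrightarrow> t < u \<Longrightarrow> s < (u :: oterm)"
proof (induction s arbitrary: t u)
  case OZero
  then show ?case by (cases t; cases u) auto
next
  case (OTerm a c b)
  obtain a' c' b' where t: "t = OTerm a' c' b'"
    using OTerm.prems(1) by (cases t) auto
  obtain a'' c'' b'' where u: "u = OTerm a'' c'' b''"
    using OTerm.prems(2) by (cases u) auto
  from OTerm show ?case
    unfolding t u by (auto dest: less_trans)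
qed

lemma less_oterm_total: "s < t \<or> s = t \<or> t < (s :: oterm)"
proof (induction s arbitrary: t)
  case OZero
  then show ?case by (cases t) auto
next
  case (OTerm a c b)
  show ?case
  proof (cases t)
    case (OTerm a' c' b')
    then show ?thesis
      using OTerm.IH(1)[of a'] OTerm.IH(2)[of b'] by auto
  qed simp
qed

instance
proof
  fix s t u :: oterm
  show "(s < t) = (s \<le> t \<and> \<not> t \<le> s)"
    unfolding less_eq_oterm_def using less_oterm_irrefl less_oterm_trans by metis
  show "s \<le> s"
    by (simp add: less_eq_oterm_def)
  show "s \<le> t \<Longrightarrow> t \<le> u \<Longrightarrow> s \<le> u"
    unfolding less_eq_oterm_def using less_oterm_trans by blast
  show "s \<le> t \<Longrightarrow> t \<le> s \<Longrightarrow> s = t"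
    unfolding less_eq_oterm_def using less_oterm_irrefl less_oterm_trans by blast
  show "s \<le> t \<or> t \<le> s"
    unfolding less_eq_oterm_def using less_oterm_total by blast
qed

end

primrec exps :: "oterm \<Rightarrow> oterm set" where
  "exps OZero = {}"
| "exps (OTerm a c b) = insert a (exps b)"

text \<open>The requirement that an ordinal be larger than its exponents is no extra condition:
  see \<open>exponent_less\<close>.\<close>

primrec cnf :: "oterm \<Rightarrow> bool" where
  "cnf OZero \<longleftrightarrow> True"
| "cnf (OTerm a c b) \<longleftrightarrow> cnf a \<and> 0 < c \<and> cnf b \<and> (\<forall>e \<in> exps b. e < a)"

lemma exponent_less: "a < OTerm a c b"
  by (induction a arbitrary: c b) auto

primrec norm_ord :: "oterm \<Rightarrow> nat" where
  "norm_ord OZero = 0"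
| "norm_ord (OTerm a c b) = max c (max (norm_ord a) (norm_ord b))"

definition below :: "oterm \<Rightarrow> oterm set" where
  "below \<alpha> = {\<beta>. cnf \<beta> \<and> \<beta> < \<alpha>}"


section \<open>Well-foundedness\<close>

definition cnf_less :: "(oterm \<times> oterm) set" where
  "cnf_less = {(s, t). cnf s \<and> cnf t \<and> s < t}"

lemma in_cnf_less: "(s, t) \<in> cnf_less \<longleftrightarrow> cnf s \<and> cnf t \<and> s < t"
  by (simp add: cnf_less_def)

lemma exps_less_mono:
  assumes "cnf s" "s \<le> t" "\<forall>e \<in> exps t. e < a"
  shows "\<forall>e \<in> exps s. e < a"
proof (cases s)
  case (OTerm a1 c1 b1)
  then obtain a2 c2 b2 where t: "t = OTerm a2 c2 b2"
    using assms(2) by (cases t) (auto simp: less_eq_oterm_def)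
  have "a1 \<le> a2"
    using assms(2) OTerm t by (auto simp: less_eq_oterm_def)
  then show ?thesis
    using assms OTerm t by (auto dest: less_trans)
qed simp

lemma acc_OTerm:
  assumes "a \<in> Wellfounded.acc cnf_less"
    and "cnf (OTerm a c b)"
  shows "OTerm a c b \<in> Wellfounded.acc cnf_less"
  using assms
proof (induction a arbitrary: c b rule: acc_induct_rule)
  case (1 a)
  note IHa = "1.IH"
  have small: "b \<in> Wellfounded.acc cnf_less" if "cnf (OTerm a c b)" for b c
  proof (cases b)
    case OZero
    show ?thesis
      unfolding OZero by (rule Wellfounded.accI) (simp add: cnf_less_def)
  next
    case (OTerm a' c' b')
    then show ?thesis
      using that IHa[of a' c' b'] by (auto simp: cnf_less_def)
  qed
  have "\<forall>b. cnf (OTerm a c b) \<longrightarrow> OTerm a c b \<in> Wellfounded.acc cnf_less" for c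
  proof (induction c rule: less_induct)
    case (less c)
    note IHc = less.IH
    have "cnf (OTerm a c b) \<longrightarrow> OTerm a c b \<in> Wellfounded.acc cnf_less"
      if "b \<in> Wellfounded.acc cnf_less" for b
      using that
    proof (induction b rule: acc_induct_rule)
      case (1 b)
      note IHb = "1.IH"
      show ?case
      proof
        assume ab: "cnf (OTerm a c b)"
        show "OTerm a c b \<in> Wellfounded.acc cnf_less"
        proof (rule Wellfounded.accI)
          fix s assume s: "(s, OTerm a c b) \<in> cnf_less"
          show "s \<in> Wellfounded.acc cnf_less"
          proof (cases s)
            case OZero
            show ?thesis
              unfolding OZero by (rule Wellfounded.accI) (simp add: cnf_less_def)
          next
            case (OTerm a' c' b')
            have cs: "cnf (OTerm a' c' b')"
              using s OTerm by (simp add: cnf_less_def)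
            consider "a' < a" | "a' = a" "c' < c" | "a' = a" "c' = c" "b' < b"
              using s OTerm by (auto simp: cnf_less_def)
            then show ?thesis
            proof cases
              case 1
              then have "(a', a) \<in> cnf_less"
                using cs ab by (simp add: cnf_less_def)
              then show ?thesis
                unfolding OTerm using IHa cs by blast
            next
              case 2
              then show ?thesis
                unfolding OTerm using IHc cs by blast
            next
              case 3
              then have "(b', b) \<in> cnf_less"
                using cs ab by (simp add: cnf_less_def)
              then show ?thesis
                unfolding OTerm using IHb cs 3 by blast
            qed
          qed
        qed
      qed
    qed
    then show ?case
      using small by blast
  qed
  then show ?case
    using "1.prems" by blast
qed

lemma wf_cnf_less: "wf cnf_less"
proof -
  have cnf: "cnf t \<Longrightarrow> t \<in> Wellfounded.acc cnf_less" for t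
  proof (induction t)
    case OZero
    show ?case by (rule Wellfounded.accI) (simp add: cnf_less_def)
  next
    case (OTerm a c b)
    then show ?case using acc_OTerm by simp
  qed
  moreover have "\<not> cnf t \<Longrightarrow> t \<in> Wellfounded.acc cnf_less" for t
    by (rule Wellfounded.accI) (simp add: cnf_less_def)
  ultimately have "\<forall>t. t \<in> Wellfounded.acc cnf_less"
    by blast
  then show ?thesis
    by (rule acc_wfI)
qed


section \<open>Ordinal addition, successors and limits\<close>

text \<open>\<open>omega_mul a c\<close> is \<open>\<omega>\<^bsup>a\<^esup> \<cdot> c\<close>.\<close>

definition omega_mul :: "oterm \<Rightarrow> nat \<Rightarrow> oterm" where
  "omega_mul a c = (if c = 0 then OZero else OTerm a c OZero)"

fun oadd :: "oterm \<Rightarrow> oterm \<Rightarrow> oterm" where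
  "oadd OZero t = t"
| "oadd s OZero = s"
| "oadd (OTerm a c b) (OTerm a' c' b') =
     (if a < a' then OTerm a' c' b'
      else if a = a' then OTerm a (c + c') b'
      else OTerm a c (oadd b (OTerm a' c' b')))"

definition osuc :: "oterm \<Rightarrow> oterm" where
  "osuc a = oadd a (omega_mul OZero 1)"

fun is_succ :: "oterm \<Rightarrow> bool" where
  "is_succ OZero \<longleftrightarrow> False"
| "is_succ (OTerm a c b) \<longleftrightarrow> (if b = OZero then a = OZero else is_succ b)"

definition is_limit :: "oterm \<Rightarrow> bool" where
  "is_limit a \<longleftrightarrow> a \<noteq> OZero \<and> \<not> is_succ a"

text \<open>The predecessor of a successor ordinal, obtained by decreasing the last coefficient.\<close>

fun succ_pred :: "oterm \<Rightarrow> oterm" where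
  "succ_pred OZero = OZero"
| "succ_pred (OTerm a c b) =
     (if b = OZero then omega_mul a (c - 1) else OTerm a c (succ_pred b))"

lemma cnf_omega_mul: "cnf a \<Longrightarrow> cnf (omega_mul a c)"
  by (simp add: omega_mul_def)

lemma less_OZero_iff [simp]: "OZero < a \<longleftrightarrow> a \<noteq> OZero"
  by (cases a) auto

lemma succ_pred_less: "cnf a \<Longrightarrow> a \<noteq> OZero \<Longrightarrow> succ_pred a < a"
  by (induction a) (auto simp: omega_mul_def)

lemma cnf_succ_pred: "cnf a \<Longrightarrow> cnf (succ_pred a)"
proof (induction a)
  case (OTerm a c b)
  show ?case
  proof (cases "b = OZero")
    case True
    then show ?thesis using OTerm.prems by (simp add: cnf_omega_mul)
  next
    case False
    have "\<forall>e \<in> exps (succ_pred b). e < a"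
      using exps_less_mono[of "succ_pred b" b a] OTerm False succ_pred_less[of b] by simp
    then show ?thesis using OTerm False by simp
  qed
qed simp

lemma succ_pred_osuc: "cnf a \<Longrightarrow> succ_pred (osuc a) = a"
proof (induction a)
  case OZero
  show ?case by (simp add: osuc_def omega_mul_def)
next
  case (OTerm a c b)
  have "osuc b \<noteq> OZero"
    by (cases b) (auto simp: osuc_def omega_mul_def)
  moreover have "b = OZero" if "a = OZero"
    using OTerm.prems that by (cases b) auto
  ultimately show ?case
    using OTerm by (auto simp: osuc_def omega_mul_def)
qed

lemma is_succ_osuc: "cnf a \<Longrightarrow> is_succ (osuc a)"
proof (induction a)
  case OZero
  show ?case by (simp add: osuc_def omega_mul_def)
next
  case (OTerm a c b)
  have "osuc b \<noteq> OZero"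
    by (cases b) (auto simp: osuc_def omega_mul_def)
  moreover have "b = OZero" if "a = OZero"
    using OTerm.prems that by (cases b) auto
  ultimately show ?case
    using OTerm by (auto simp: osuc_def omega_mul_def)
qed

lemma osuc_succ_pred: "cnf a \<Longrightarrow> is_succ a \<Longrightarrow> osuc (succ_pred a) = a"
proof (induction a)
  case (OTerm a c b)
  have "a \<noteq> OZero" if "b \<noteq> OZero"
    using OTerm.prems that by (cases b) auto
  then show ?case
    using OTerm by (auto simp: osuc_def omega_mul_def split: if_splits)
qed simp

lemma exps_osuc: "cnf a \<Longrightarrow> exps (osuc a) \<subseteq> insert OZero (exps a)"
proof (induction a)
  case (OTerm a c b)
  then show ?case by (auto simp: osuc_def omega_mul_def)
qed (simp add: osuc_def omega_mul_def)

lemma cnf_osuc: "cnf a \<Longrightarrow> cnf (osuc a)"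
proof (induction a)
  case (OTerm a c b)
  then show ?case using exps_osuc[of b] by (auto simp: osuc_def omega_mul_def)
qed (simp add: osuc_def omega_mul_def)

lemma is_succ_iff: "cnf a \<Longrightarrow> is_succ a \<longleftrightarrow> (\<exists>b. cnf b \<and> a = osuc b)"
  using cnf_succ_pred is_succ_osuc osuc_succ_pred by metis


section \<open>Fundamental sequences\<close>

text \<open>Only meaningful on limits. The last summand \<open>\<omega>\<^bsup>a\<^esup> \<cdot> c\<close> is read as
  \<open>\<omega>\<^bsup>a\<^esup> \<cdot> (c - 1) + \<omega>\<^bsup>a\<^esup>\<close>; the defining equations are recovered as \<open>fund_succ\<close> and
  \<open>fund_limit\<close> below.\<close>

fun fund :: "oterm \<Rightarrow> nat \<Rightarrow> oterm" where
  "fund OZero x = OZero"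
| "fund (OTerm a c b) x =
     (if b \<noteq> OZero then OTerm a c (fund b x)
      else oadd (omega_mul a (c - 1))
             (if is_succ a then omega_mul (succ_pred a) (x + 1)
              else omega_mul (fund a x) 1))"

lemma oadd_omega_mul:
  assumes "p < a" "0 < d"
  shows "oadd (omega_mul a c) (omega_mul p d) =
    (if c = 0 then OTerm p d OZero else OTerm a c (OTerm p d OZero))"
  using assms by (auto simp: omega_mul_def)

lemma fund_less: "cnf a \<Longrightarrow> is_limit a \<Longrightarrow> fund a x < a"
proof (induction a)
  case OZero
  then show ?case by (simp add: is_limit_def)
next
  case (OTerm a c b)
  show ?case
  proof (cases "b = OZero")
    case True
    then have "a \<noteq> OZero"
      using OTerm.prems by (auto simp: is_limit_def)
    then show ?thesis
      using True OTerm succ_pred_less[of a] by (auto simp: oadd_omega_mul is_limit_def)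
  next
    case False
    then show ?thesis
      using OTerm by (auto simp: is_limit_def)
  qed
qed

lemma cnf_fund: "cnf a \<Longrightarrow> is_limit a \<Longrightarrow> cnf (fund a x)"
proof (induction a)
  case OZero
  then show ?case by (simp add: is_limit_def)
next
  case (OTerm a c b)
  show ?case
  proof (cases "b = OZero")
    case True
    then have "a \<noteq> OZero"
      using OTerm.prems by (auto simp: is_limit_def)
    then show ?thesis
      using True OTerm succ_pred_less[of a] cnf_succ_pred[of a] fund_less[of a x]
      by (auto simp: oadd_omega_mul is_limit_def)
  next
    case False
    then have b: "cnf b" "is_limit b" "cnf (fund b x)"
      using OTerm by (auto simp: is_limit_def)
    have "\<forall>e \<in> exps (fund b x). e < a"
      using exps_less_mono[of "fund b x" b a] b OTerm.prems fund_less[of b x] by simp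
    then show ?thesis
      using False b OTerm.prems by simp
  qed
qed

lemma fund_omega_pow:
  "fund (omega_mul a 1) x =
    (if is_succ a then omega_mul (succ_pred a) (x + 1) else omega_mul (fund a x) 1)"
  by (simp add: omega_mul_def)

lemma fund_last:
  assumes "cnf \<gamma>" "cnf a" "a \<noteq> OZero" "\<forall>e \<in> exps \<gamma>. a \<le> e"
  shows "fund (oadd \<gamma> (omega_mul a 1)) x = oadd \<gamma> (fund (omega_mul a 1) x)"
  using assms(1,4)
proof (induction \<gamma>)
  case OZero
  show ?case by simp
next
  case (OTerm a' c' b')
  obtain p d where F: "fund (omega_mul a 1) x = OTerm p d OZero" and "p < a"
  proof (cases "is_succ a")
    case True
    show ?thesis
      using succ_pred_less[of a] assms True
      by (intro that[of "succ_pred a" "x + 1"]) (simp_all add: omega_mul_def)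
  next
    case False
    show ?thesis
      using fund_less[of a x] assms False
      by (intro that[of "fund a x" 1]) (simp_all add: omega_mul_def is_limit_def)
  qed
  have "a \<le> a'"
    using OTerm.prems by simp
  show ?case
  proof (cases "a = a'")
    case True
    have "b' = OZero"
      using OTerm.prems True by (cases b') auto
    moreover have "0 < c'"
      using OTerm.prems by simp
    moreover have "oadd \<gamma> (fund (omega_mul a 1) x) = oadd \<gamma>
      (if is_succ a then omega_mul (succ_pred a) (x + 1) else omega_mul (fund a x) 1)" for \<gamma>
      by (simp only: fund_omega_pow)
    ultimately show ?thesis
      using True by (simp add: omega_mul_def)
  next
    case False
    then have "a < a'" "p < a'"
      using \<open>a \<le> a'\<close> \<open>p < a\<close> by (auto dest: less_le_trans)
    moreover have "oadd b' (omega_mul a 1) \<noteq> OZero"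
      by (cases b') (auto simp: omega_mul_def)
    moreover have "oadd (OTerm a' c' b') (omega_mul a 1) = OTerm a' c' (oadd b' (omega_mul a 1))"
      using \<open>a < a'\<close> by (auto simp: omega_mul_def)
    ultimately show ?thesis
      using OTerm F by auto
  qed
qed

lemma fund_succ:
  assumes "cnf \<gamma>" "cnf \<beta>" "\<forall>e \<in> exps \<gamma>. osuc \<beta> \<le> e"
  shows "fund (oadd \<gamma> (omega_mul (osuc \<beta>) 1)) x = oadd \<gamma> (omega_mul \<beta> (x + 1))"
proof -
  have "osuc \<beta> \<noteq> OZero"
    using is_succ_osuc[OF assms(2)] by auto
  then show ?thesis
    using fund_last[OF assms(1) cnf_osuc[OF assms(2)] _ assms(3)] assms(2)
    by (simp add: fund_omega_pow[simplified] is_succ_osuc succ_pred_osuc)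
qed

lemma fund_limit:
  assumes "cnf \<gamma>" "cnf l" "is_limit l" "\<forall>e \<in> exps \<gamma>. l \<le> e"
  shows "fund (oadd \<gamma> (omega_mul l 1)) x = oadd \<gamma> (omega_mul (fund l x) 1)"
  using fund_last[OF assms(1,2) _ assms(4)] assms(3)
  by (simp add: fund_omega_pow[simplified] is_limit_def)


section \<open>Predecessors and the Cichon hierarchy\<close>

text \<open>The \<open>cnf\<close> guards only serve to make the recursions terminate on junk terms; for the
  recursion equations on ordinals see \<open>pred_osuc\<close>, \<open>pred_limit\<close> and \<open>cichon_pos\<close>.\<close>

function pred :: "nat \<Rightarrow> oterm \<Rightarrow> oterm" where
  "pred x a = (if cnf a \<and> is_limit a then pred x (fund a x) else succ_pred a)"
  by auto
termination
  by (relation "inv_image cnf_less snd")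
    (auto simp: wf_cnf_less in_cnf_less fund_less cnf_fund)

declare pred.simps [simp del]

lemma pred_osuc: "cnf a \<Longrightarrow> pred x (osuc a) = a"
  by (subst pred.simps) (simp add: is_limit_def is_succ_osuc succ_pred_osuc)

lemma pred_limit: "cnf a \<Longrightarrow> is_limit a \<Longrightarrow> pred x a = pred x (fund a x)"
  by (subst pred.simps) simp

lemma fund_nonzero: "is_limit a \<Longrightarrow> fund a x \<noteq> OZero"
  by (cases a) (auto simp: omega_mul_def is_limit_def)

lemma cnf_pred_less: "cnf a \<Longrightarrow> a \<noteq> OZero \<Longrightarrow> cnf (pred x a) \<and> pred x a < a"
proof (induction x a rule: pred.induct)
  case (1 x a)
  show ?case
  proof (cases "is_limit a")
    case True
    then show ?thesis
      using 1 pred_limit[of a x] cnf_fund[of a x] fund_less[of a x] fund_nonzero[of a x]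
      by (auto dest: less_trans)
  next
    case False
    then show ?thesis
      using 1 by (subst (1 2) pred.simps) (simp add: cnf_succ_pred succ_pred_less)
  qed
qed

function cichon :: "(nat \<Rightarrow> nat) \<Rightarrow> oterm \<Rightarrow> nat \<Rightarrow> nat" where
  "cichon g a x = (if cnf a \<and> a \<noteq> OZero then 1 + cichon g (pred x a) (g x) else 0)"
  by auto
termination
  by (relation "inv_image cnf_less (\<lambda>(g, a, x). a)")
    (auto simp: wf_cnf_less in_cnf_less cnf_pred_less)

declare cichon.simps [simp del]

lemma cichon_OZero: "cichon g OZero x = 0"
  by (simp add: cichon.simps)

lemma cichon_pos: "cnf a \<Longrightarrow> a \<noteq> OZero \<Longrightarrow> cichon g a x = 1 + cichon g (pred x a) (g x)"
  by (subst cichon.simps) simp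


section \<open>Controlled bad sequences and the length function\<close>

text \<open>A sequence of length \<open>l\<close>, finite or infinite, is a function on \<open>nat\<close> of which only the
  values at indices less than \<open>l\<close> matter.\<close>

definition bad :: "(nat \<Rightarrow> oterm) \<Rightarrow> enat \<Rightarrow> bool" where
  "bad \<beta> l \<longleftrightarrow> (\<forall>i j. i < j \<longrightarrow> enat j < l \<longrightarrow> \<beta> j < \<beta> i)"

definition controlled :: "(nat \<Rightarrow> nat) \<Rightarrow> nat \<Rightarrow> (nat \<Rightarrow> oterm) \<Rightarrow> enat \<Rightarrow> bool" where
  "controlled g n \<beta> l \<longleftrightarrow> (\<forall>i. enat i < l \<longrightarrow> norm_ord (\<beta> i) \<le> (g ^^ i) n)"

definition seq_over :: "oterm \<Rightarrow> (nat \<Rightarrow> oterm) \<Rightarrow> enat \<Rightarrow> bool" where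
  "seq_over \<alpha> \<beta> l \<longleftrightarrow> (\<forall>i. enat i < l \<longrightarrow> \<beta> i \<in> below \<alpha>)"

definition bad_lengths :: "(nat \<Rightarrow> nat) \<Rightarrow> oterm \<Rightarrow> nat \<Rightarrow> enat set" where
  "bad_lengths g \<alpha> n = {l. \<exists>\<beta>. seq_over \<alpha> \<beta> l \<and> bad \<beta> l \<and> controlled g n \<beta> l}"

text \<open>The supremum is taken in \<open>enat\<close>, so a finite value is an attained maximum
  (\<open>L_eq_enat_iff\<close>) and unboundedly long sequences would give \<open>\<infinity>\<close>.\<close>

definition L :: "(nat \<Rightarrow> nat) \<Rightarrow> oterm \<Rightarrow> nat \<Rightarrow> enat" where
  "L g \<alpha> n = Sup (bad_lengths g \<alpha> n)"

lemma L_eq_enat_iff: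
  "L g \<alpha> n = enat k \<longleftrightarrow>
     enat k \<in> bad_lengths g \<alpha> n \<and> (\<forall>l \<in> bad_lengths g \<alpha> n. l \<le> enat k)"
proof
  assume L: "L g \<alpha> n = enat k"
  have ub: "\<forall>l \<in> bad_lengths g \<alpha> n. l \<le> enat k"
    using L unfolding L_def by (metis Sup_upper)
  have zero: "0 \<in> bad_lengths g \<alpha> n"
    by (auto simp: bad_lengths_def seq_over_def bad_def controlled_def)
  have "finite (bad_lengths g \<alpha> n)"
    using ub finite_enat_bounded by blast
  then have "Sup (bad_lengths g \<alpha> n) \<in> bad_lengths g \<alpha> n"
    using zero by (auto simp: Sup_enat_def intro!: Max_in)
  then show "enat k \<in> bad_lengths g \<alpha> n \<and> (\<forall>l \<in> bad_lengths g \<alpha> n. l \<le> enat k)"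
    using ub L by (simp add: L_def)
next
  assume "enat k \<in> bad_lengths g \<alpha> n \<and> (\<forall>l \<in> bad_lengths g \<alpha> n. l \<le> enat k)"
  then show "L g \<alpha> n = enat k"
    unfolding L_def by (intro antisym Sup_least Sup_upper) auto
qed

end

theory Submission
  imports Defs
begin

text \<open>When \<open>N \<alpha> \<le> x\<close>, the predecessor \<open>P\<^sub>x \<alpha>\<close> is the largest ordinal below \<open>\<alpha>\<close> of norm at
  most \<open>x\<close>. A controlled bad sequence over \<open>\<alpha>\<close> therefore starts at or below \<open>P\<^sub>x \<alpha>\<close> and its tail
  is a \<open>(g, g x)\<close>-controlled bad sequence over \<open>P\<^sub>x \<alpha>\<close>; conversely \<open>P\<^sub>x \<alpha>\<close> can be put in front of
  any such sequence. Hence the length function satisfies the recursion that defines the Cichon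
  hierarchy.\<close>

section \<open>Maximality of the predecessor among smaller ordinals of bounded norm\<close>

lemma less_imp_le_succ_pred:
  assumes "cnf a" "is_succ a" "cnf b" "b < a"
  shows "b \<le> succ_pred a"
  using assms
proof (induction a arbitrary: b)
  case (OTerm a c r)
  show ?case
  proof (cases b)
    case (OTerm a' c' r')
    show ?thesis
    proof (cases "r = OZero")
      case True
      then have "a = OZero" "a' = OZero" "0 < c'" "c' < c"
        using OTerm.prems \<open>b = _\<close> by auto
      moreover have "r' = OZero"
        using OTerm.prems \<open>b = _\<close> \<open>a' = OZero\<close> by (cases r') auto
      ultimately show ?thesis
        using True \<open>b = _\<close> by (auto simp: omega_mul_def less_eq_oterm_def)
    next
      case False
      then show ?thesis
        using OTerm.prems OTerm.IH(2)[of r'] \<open>b = _\<close> by (auto simp: less_eq_oterm_def)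
    qed
  qed (auto simp: less_eq_oterm_def)
qed simp

text \<open>The norm bound keeps the coefficients of \<open>b\<close> below the new coefficient
  \<open>x + 1\<close>, and it passes to the exponents of \<open>b\<close>, so limit exponents are
  handled by induction.\<close>

lemma less_fund:
  assumes "cnf a" "is_limit a" "cnf b" "b < a" "norm_ord b \<le> x"
  shows "b < fund a x"
  using assms
proof (induction a arbitrary: b)
  case (OTerm a c r)
  show ?case
  proof (cases b)
    case OZero
    then show ?thesis
      using fund_nonzero[OF OTerm.prems(2)] by simp
  next
    case b: (OTerm a' c' r')
    show ?thesis
    proof (cases "r = OZero")
      case False
      then show ?thesis
        using OTerm.prems OTerm.IH(2)[of r'] b by (auto simp: is_limit_def)
    next
      case r: True
      \<comment> \<open>The fundamental sequence trades one copy of \<open>\<omega>\<^sup>a\<close>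
        for the single summand \<open>OTerm p d OZero\<close>.\<close>
      define p where "p = (if is_succ a then succ_pred a else fund a x)"
      define d where "d = (if is_succ a then x + 1 else 1)"
      have a: "a \<noteq> OZero"
        using OTerm.prems r by (auto simp: is_limit_def)
      have "p < a"
        using a OTerm.prems succ_pred_less[of a] fund_less[of a x]
        by (auto simp: p_def is_limit_def)
      then have fund: "fund (OTerm a c r) x =
          (if c - 1 = 0 then OTerm p d OZero else OTerm a (c - 1) (OTerm p d OZero))"
        using r oadd_omega_mul[of p a d "c - 1"] by (auto simp: p_def d_def)
      \<comment> \<open>For a successor \<open>a\<close>, \<open>e \<le> p\<close> and a tie is
        decided by \<open>k \<le> x < d\<close>. For a limit \<open>a\<close>, induction on the
        exponent gives \<open>e < p\<close>.\<close>
      have lt: "OTerm e k s < OTerm p d OZero"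
        if "e < a" "cnf (OTerm e k s)" "norm_ord (OTerm e k s) \<le> x" for e k s
      proof (cases "is_succ a")
        case True
        then show ?thesis
          using that less_imp_le_succ_pred[of a e] OTerm.prems
          by (auto simp: p_def d_def less_eq_oterm_def)
      next
        case False
        then show ?thesis
          using that OTerm.IH(1)[of e] OTerm.prems a by (auto simp: p_def is_limit_def)
      qed
      show ?thesis
      proof (cases "a' < a")
        case True
        then show ?thesis
          unfolding fund b using lt OTerm.prems b by auto
      next
        case False
        \<comment> \<open>As \<open>r\<close> is zero, an equal exponent forces a smaller
          coefficient. At worst \<open>c' = c - 1\<close>, and then \<open>r'\<close> has to be
          compared with \<open>OTerm p d OZero\<close>.\<close>
        then have eq: "a' = a" and c: "0 < c'" "c' < c"
          using OTerm.prems b r by auto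
        have "r' < OTerm p d OZero"
          using lt OTerm.prems b eq by (cases r') auto
        then show ?thesis
          unfolding fund b using eq c by auto
      qed
    qed
  qed
qed simp

text \<open>By \<open>less_fund\<close>, \<open>b\<close> stays below every fundamental term on the
  way down to a successor, where nothing fits between \<open>succ_pred\<close> and the ordinal
  itself.\<close>

lemma le_pred:
  assumes "cnf a" "a \<noteq> OZero" "cnf b" "b < a" "norm_ord b \<le> x"
  shows "b \<le> pred x a"
  using assms
proof (induction x a rule: pred.induct)
  case (1 x a)
  then show ?case
    using less_fund[of a b x] cnf_fund[of a x] fund_nonzero[of a x] less_imp_le_succ_pred[of a b]
    by (cases "is_limit a") (auto simp: pred.simps[of x a] is_limit_def)
qed

section \<open>Norm of the predecessor\<close>

text \<open>Passing from a limit to its \<open>x\<close>-th fundamental term may create one coefficient \<open>x + 1\<close>, but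
  only at the very end of the term or of its last exponents. This invariant survives until the
  predecessor is taken, which lowers exactly that coefficient.\<close>

fun almost_lean :: "nat \<Rightarrow> oterm \<Rightarrow> bool" where
  "almost_lean x OZero \<longleftrightarrow> True"
| "almost_lean x (OTerm a c b) \<longleftrightarrow>
     (if b = OZero then c \<le> 1 \<and> almost_lean x a \<or> c \<le> x + 1 \<and> norm_ord a \<le> x
      else c \<le> x \<and> norm_ord a \<le> x \<and> almost_lean x b)"

lemma almost_lean_if_norm_le: "norm_ord a \<le> x \<Longrightarrow> almost_lean x a"
  by (induction a) auto

lemma norm_succ_pred_le: "is_succ a \<Longrightarrow> almost_lean x a \<Longrightarrow> norm_ord (succ_pred a) \<le> x"
  by (induction a) (auto simp: omega_mul_def split: if_splits)

text \<open>A successor exponent yields the final coefficient \<open>x + 1\<close> over an exponent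
  of norm at most \<open>x\<close>; a limit exponent yields coefficient 1, so the invariant for
  \<open>fund a x\<close> suffices.\<close>

lemma almost_lean_fund:
  assumes "cnf a" "is_limit a" "almost_lean x a"
  shows "almost_lean x (fund a x)"
  using assms
proof (induction a)
  case (OTerm a c r)
  show ?case
  proof (cases "r = OZero")
    case False
    then show ?thesis
      using OTerm.prems OTerm.IH(2) fund_nonzero[of r x] by (auto simp: is_limit_def)
  next
    case True
    then have a: "a \<noteq> OZero"
      using OTerm.prems by (auto simp: is_limit_def)
    \<comment> \<open>If \<open>c = 1\<close>, the exponent \<open>a\<close> disappears from the
      result and may itself be oversized; otherwise it survives with coefficient
      \<open>c - 1 \<le> x\<close>.\<close>
    have al: "almost_lean x a" and c: "0 < c" "c = 1 \<or> c \<le> x + 1 \<and> norm_ord a \<le> x"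
      using True OTerm.prems almost_lean_if_norm_le by auto
    show ?thesis
    proof (cases "is_succ a")
      case s: True
      show ?thesis
        using True s c al a OTerm.prems norm_succ_pred_le[OF s al] succ_pred_less[of a]
        by (auto simp: oadd_omega_mul)
    next
      case s: False
      then have "almost_lean x (fund a x)" "fund a x < a"
        using OTerm.IH(1) OTerm.prems al a fund_less[of a x] by (auto simp: is_limit_def)
      then show ?thesis
        using True s c by (auto simp: oadd_omega_mul)
    qed
  qed
qed simp

text \<open>Assuming only \<open>almost_lean\<close> lets the induction pass through limits, where
  the bound on the norm itself can fail.\<close>

lemma norm_pred_le:
  assumes "cnf a" "a \<noteq> OZero" "almost_lean x a"
  shows "norm_ord (pred x a) \<le> x"
  using assms
proof (induction x a rule: pred.induct)
  case (1 x a)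
  then show ?case
    using almost_lean_fund[of a x] cnf_fund[of a x] fund_nonzero[of a x] norm_succ_pred_le[of a x]
    by (cases "is_limit a") (auto simp: pred.simps[of x a] is_limit_def)
qed

section \<open>Recursion for the lengths of controlled bad sequences\<close>

lemma zero_in_bad_lengths: "0 \<in> bad_lengths g \<alpha> n"
  by (auto simp: bad_lengths_def seq_over_def bad_def controlled_def)

lemma bad_lengths_OZero: "bad_lengths g OZero n = {0}"
proof -
  have "l = 0" if "seq_over OZero \<beta> l" for \<beta> l
    using that unfolding seq_over_def below_def by (cases l) (auto simp: zero_enat_def)
  then show ?thesis
    using zero_in_bad_lengths by (auto simp: bad_lengths_def)
qed

text \<open>Infinity is its own \<open>eSuc\<close>, so infinite sequences also fall under the
  second case.\<close>

lemma enat_eSuc_cases: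
  obtains "l = 0" | l' where "l = eSuc l'"
proof (cases l)
  case (enat k)
  then show thesis
    using that(1) that(2)[of "enat (k - 1)"] by (cases k) (simp_all add: zero_enat_def eSuc_enat)
next
  case infinity
  then show thesis
    using that(2)[of \<infinity>] by simp
qed

lemma eSuc_in_bad_lengths_iff:
  assumes "cnf \<alpha>" "\<alpha> \<noteq> OZero" "norm_ord \<alpha> \<le> x"
  shows "eSuc l \<in> bad_lengths g \<alpha> x \<longleftrightarrow> l \<in> bad_lengths g (pred x \<alpha>) (g x)"
proof
  assume "eSuc l \<in> bad_lengths g \<alpha> x"
  then obtain \<beta> where \<beta>: "seq_over \<alpha> \<beta> (eSuc l)" "bad \<beta> (eSuc l)" "controlled g x \<beta> (eSuc l)"
    by (auto simp: bad_lengths_def)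
  have "enat 0 < eSuc l"
    by (simp flip: zero_enat_def)
  then have "cnf (\<beta> 0)" "\<beta> 0 < \<alpha>" "norm_ord (\<beta> 0) \<le> x"
    using \<beta> by (fastforce simp: seq_over_def below_def controlled_def)+
  then have le: "\<beta> 0 \<le> pred x \<alpha>"
    using le_pred assms by blast
  have "seq_over (pred x \<alpha>) (\<lambda>i. \<beta> (Suc i)) l"
    unfolding seq_over_def below_def
  proof (intro allI impI)
    fix i assume "enat i < l"
    then have i: "enat (Suc i) < eSuc l"
      by (simp add: Suc_ile_eq)
    then have "\<beta> (Suc i) < \<beta> 0" "cnf (\<beta> (Suc i))"
      using \<beta> by (auto simp: bad_def seq_over_def below_def)
    then show "\<beta> (Suc i) \<in> {\<beta>. cnf \<beta> \<and> \<beta> < pred x \<alpha>}"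
      using le by auto
  qed
  moreover have "bad (\<lambda>i. \<beta> (Suc i)) l"
    unfolding bad_def
  proof (intro allI impI)
    fix i j assume "i < j" "enat j < l"
    then have "Suc i < Suc j" "enat (Suc j) < eSuc l"
      by (simp_all add: Suc_ile_eq)
    then show "\<beta> (Suc j) < \<beta> (Suc i)"
      using \<beta>(2) unfolding bad_def by blast
  qed
  moreover have "controlled g (g x) (\<lambda>i. \<beta> (Suc i)) l"
    unfolding controlled_def
  proof (intro allI impI)
    fix i assume "enat i < l"
    then have "enat (Suc i) < eSuc l"
      by (simp add: Suc_ile_eq)
    then have "norm_ord (\<beta> (Suc i)) \<le> (g ^^ Suc i) x"
      using \<beta>(3) unfolding controlled_def by blast
    then show "norm_ord (\<beta> (Suc i)) \<le> (g ^^ i) (g x)"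
      by (simp add: funpow_swap1)
  qed
  ultimately show "l \<in> bad_lengths g (pred x \<alpha>) (g x)"
    by (auto simp: bad_lengths_def)
next
  assume "l \<in> bad_lengths g (pred x \<alpha>) (g x)"
  then obtain \<beta> where \<beta>: "seq_over (pred x \<alpha>) \<beta> l" "bad \<beta> l" "controlled g (g x) \<beta> l"
    by (auto simp: bad_lengths_def)
  define \<gamma> where "\<gamma> = case_nat (pred x \<alpha>) \<beta>"
  have pred: "cnf (pred x \<alpha>)" "pred x \<alpha> < \<alpha>" "norm_ord (pred x \<alpha>) \<le> x"
    using cnf_pred_less norm_pred_le almost_lean_if_norm_le assms by auto
  have \<beta>_less: "cnf (\<beta> i)" "\<beta> i < pred x \<alpha>" if "enat i < l" for i
    using \<beta>(1) that by (auto simp: seq_over_def below_def)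
  have "seq_over \<alpha> \<gamma> (eSuc l)"
    unfolding seq_over_def below_def
  proof (intro allI impI)
    fix i assume "enat i < eSuc l"
    then show "\<gamma> i \<in> {\<beta>. cnf \<beta> \<and> \<beta> < \<alpha>}"
      using pred \<beta>_less by (cases i) (auto simp: \<gamma>_def Suc_ile_eq intro: less_trans)
  qed
  moreover have "bad \<gamma> (eSuc l)"
    unfolding bad_def
  proof (intro allI impI)
    fix i j :: nat assume "i < j" "enat j < eSuc l"
    then show "\<gamma> j < \<gamma> i"
      using \<beta>(2) \<beta>_less by (cases i; cases j) (auto simp: \<gamma>_def Suc_ile_eq bad_def)
  qed
  moreover have "controlled g x \<gamma> (eSuc l)"
    unfolding controlled_def
  proof (intro allI impI)
    fix i assume "enat i < eSuc l"
    then show "norm_ord (\<gamma> i) \<le> (g ^^ i) x"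
      using \<beta>(3) pred by (cases i) (auto simp: \<gamma>_def Suc_ile_eq controlled_def funpow_swap1)
  qed
  ultimately show "eSuc l \<in> bad_lengths g \<alpha> x"
    by (auto simp: bad_lengths_def)
qed

theorem theorem3p3:
  fixes g :: "nat \<Rightarrow> nat" and \<alpha> :: oterm and x :: nat
  assumes "mono g"
    and "\<And>y. y \<le> g y"
    and "cnf \<alpha>"
    and "norm_ord \<alpha> \<le> x"
  shows "L g \<alpha> x = enat (cichon g \<alpha> x)"
  using wf_cnf_less assms(3,4)
proof (induction \<alpha> arbitrary: x rule: wf_induct_rule)
  case (less \<alpha>)
  show ?case
  proof (cases "\<alpha> = OZero")
    case True
    then show ?thesis
      by (simp add: L_def bad_lengths_OZero cichon_OZero flip: zero_enat_def)
  next
    case False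
    have pred: "cnf (pred x \<alpha>)" "pred x \<alpha> < \<alpha>"
      using cnf_pred_less less.prems False by auto
    \<comment> \<open>Expansiveness restores the norm hypothesis at the next argument
      \<open>g x\<close>.\<close>
    have "norm_ord (pred x \<alpha>) \<le> g x"
      using norm_pred_le[of \<alpha> x] almost_lean_if_norm_le[of \<alpha> x] less.prems False assms(2)[of x]
      by simp
    then have "L g (pred x \<alpha>) (g x) = enat (cichon g (pred x \<alpha>) (g x))"
      using less.IH[of "pred x \<alpha>" "g x"] pred less.prems by (simp add: in_cnf_less)
    \<comment> \<open>A finite supremum is an attained maximum; attainment and upper bound are
      carried through \<open>eSuc\<close> separately.\<close>
    then have IH: "enat (cichon g (pred x \<alpha>) (g x)) \<in> bad_lengths g (pred x \<alpha>) (g x)"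
      "\<And>l. l \<in> bad_lengths g (pred x \<alpha>) (g x) \<Longrightarrow> l \<le> enat (cichon g (pred x \<alpha>) (g x))"
      by (auto simp: L_eq_enat_iff)
    have step: "eSuc l \<in> bad_lengths g \<alpha> x \<longleftrightarrow> l \<in> bad_lengths g (pred x \<alpha>) (g x)" for l
      using eSuc_in_bad_lengths_iff less.prems False by blast
    have eq: "enat (cichon g \<alpha> x) = eSuc (enat (cichon g (pred x \<alpha>) (g x)))"
      using cichon_pos[of \<alpha> g x] less.prems False by (simp add: eSuc_enat)
    have "l \<le> eSuc (enat (cichon g (pred x \<alpha>) (g x)))" if "l \<in> bad_lengths g \<alpha> x" for l
    proof (cases l rule: enat_eSuc_cases)
      case (2 l')
      then show ?thesis
        using that IH(2)[of l'] step[of l'] by simp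
    qed simp
    moreover have "eSuc (enat (cichon g (pred x \<alpha>) (g x))) \<in> bad_lengths g \<alpha> x"
      using IH(1) step by simp
    ultimately show ?thesis
      unfolding L_def eq by (intro antisym Sup_least Sup_upper)
  qed
qed

end
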